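(* Let $0 \le p \le q \le r < \infty$ and $1 \le r < a < \infty$, let $\sigma > 0$, let $V$ be a real Banach space, and let $A : \ell_r \to V$ be an injective bounded non-compact linear operator with non-closed range such that, for some constants $0 < d_1 \le d_2 < \infty$, $$ d_1 \|u\|_a \le \|Au\|_V \le d_2 \|u\|_a \qquad (u \in \ell_r). $$ Let $u^\dagger \in \ell_q$ and $v := A u^\dagger$. For each $\delta > 0$ let $v^\delta \in V$ satisfy $\|v^\delta - v\|_V \le \delta$, put $\alpha_\delta := \delta^{\sigma + \frac{(q-p)a}{a-q}}$, and let $u_{\alpha_\delta}^\delta \in \ell_p$ be a minimizer over $\ell_r$ of the Tikhonov functional $T_\alpha^\delta(u) = \|Au - v^\delta\|_V^\sigma + \alpha\, \mathcal{R}_p(u)$ with $\alpha = \alpha_\delta$. Let $$ v_\beta^\delta := H_\beta(u_{\alpha_\delta}^\delta) \quad (\beta > 0), \qquad \beta_\delta := \delta^{\frac{a}{a-q}} \quad (\delta > 0). $$ Then $$ \|v_{\beta_\delta}^\delta - u^\dagger\|_r = \mathcal{O}(\delta^{\gamma_1}), \qquad \mathcal{R}_p(v_{\beta_\delta}^\delta) = \mathcal{O}(\delta^{-\gamma_2}) \qquad \text{as } \delta \to 0, $$ where $$ \gamma_1 = \frac{a}{r} \cdot \frac{r-q}{a-q}, \qquad \gamma_2 = \frac{(q-p)a}{a-q}. $$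
   Context: All sequences are real and indexed by $k = 1,2,\ldots$. For $0 < s < \infty$, $\|u\|_s := (\sum_{k=1}^\infty |u_k|^s)^{1/s}$ and $\ell_s := \{u = (u_k)_{k\ge1} : \|u\|_s < \infty\}$ (a Banach space for $s \ge 1$, a quasi-normed space for $0<s<1$). For $s = 0$, $\|u\|_0 := \#\{k \in \mathbb{N} : u_k \ne 0\}$ and $\ell_0 := \{u : \|u\|_0 < \infty\}$. One has $\ell_p \subset \ell_q \subset \ell_r \subset \ell_a$ for $0 \le p \le q \le r < a$. The penalty functional is $\mathcal{R}_p(u) := \|u\|_p^p$ for $p > 0$ and $\mathcal{R}_0(u) := \|u\|_0$; it takes the value $+\infty$ for $u \notin \ell_p$, so $T_\alpha^\delta(u)$ is finite if and only if $u \in \ell_p$. Hard thresholding at level $\beta > 0$ maps a sequence $u = (u_n)_{n\ge1}$ to the sequence $H_\beta(u)$ with $H_\beta(u)_n = u_n$ if $|u_n| \ge \beta$ and $H_\beta(u)_n = 0$ otherwise. *)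

theory Defs
  imports "HOL-Analysis.Analysis"
begin

text \<open>
  A real sequence is a function on \<^typ>\<open>nat\<close>, starting at index 0 instead of 1; nothing below
  depends on the labels. Norms and penalties live in \<^typ>\<open>ennreal\<close>, so that they are
  \<open>top\<close> exactly when the defining sum diverges (a real-valued \<^const>\<open>suminf\<close> would be
  unspecified there).
\<close>

text \<open>Powers with a positive real exponent, extended by \<open>top\<close> at \<open>top\<close>.\<close>

definition ennreal_powr :: "ennreal \<Rightarrow> real \<Rightarrow> ennreal" where
  "ennreal_powr x t = (if x = top then top else ennreal (enn2real x powr t))"

text \<open>
  The case \<open>s = 0\<close> is the number of nonzero entries: \<open>emeasure (count_space UNIV)\<close> is the
  cardinality on finite sets and \<open>top\<close> on infinite ones.
\<close>

definition lnorm :: "real \<Rightarrow> (nat \<Rightarrow> real) \<Rightarrow> ennreal" where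
  "lnorm s u =
    (if s = 0 then emeasure (count_space UNIV) {k. u k \<noteq> 0}
     else ennreal_powr (\<Sum>k. ennreal (\<bar>u k\<bar> powr s)) (1 / s))"

definition ell :: "real \<Rightarrow> (nat \<Rightarrow> real) set" where
  "ell s = {u. lnorm s u < top}"

definition penalty :: "real \<Rightarrow> (nat \<Rightarrow> real) \<Rightarrow> ennreal" where
  "penalty p u = (if p = 0 then lnorm 0 u else ennreal_powr (lnorm p u) p)"

definition hard_threshold :: "real \<Rightarrow> (nat \<Rightarrow> real) \<Rightarrow> nat \<Rightarrow> real" where
  "hard_threshold \<beta> u = (\<lambda>n. if \<bar>u n\<bar> \<ge> \<beta> then u n else 0)"

text \<open>
  Operators on \<open>\<ell>\<^sub>r\<close> are total functions on sequences of which only the restriction to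
  \<^term>\<open>ell r\<close> matters.
\<close>

definition bounded_linear_on_ell ::
    "real \<Rightarrow> ((nat \<Rightarrow> real) \<Rightarrow> 'v::real_normed_vector) \<Rightarrow> bool" where
  "bounded_linear_on_ell r A \<longleftrightarrow>
    (\<forall>u\<in>ell r. \<forall>w\<in>ell r. A (\<lambda>k. u k + w k) = A u + A w) \<and>
    (\<forall>c. \<forall>u\<in>ell r. A (\<lambda>k. c * u k) = c *\<^sub>R A u) \<and>
    (\<exists>M. \<forall>u\<in>ell r. ennreal (norm (A u)) \<le> ennreal M * lnorm r u)"

definition compact_operator_on_ell ::
    "real \<Rightarrow> ((nat \<Rightarrow> real) \<Rightarrow> 'v::real_normed_vector) \<Rightarrow> bool" where
  "compact_operator_on_ell r A \<longleftrightarrow> compact (closure (A ` {u. lnorm r u \<le> 1}))"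

definition tikhonov ::
    "((nat \<Rightarrow> real) \<Rightarrow> 'v::real_normed_vector) \<Rightarrow> real \<Rightarrow> real \<Rightarrow> real \<Rightarrow> 'v \<Rightarrow> (nat \<Rightarrow> real) \<Rightarrow> ennreal"
  where
  "tikhonov A \<sigma> p \<alpha> y u = ennreal (norm (A u - y) powr \<sigma>) + ennreal \<alpha> * penalty p u"

end

theory Submission
  imports Defs
begin

text \<open>
  The truncation of \<open>u_dag\<close> at level \<open>\<beta> \<delta>\<close> is admissible for the Tikhonov functional and has
  value \<open>O(\<delta> powr \<sigma>)\<close>. Minimality transfers this to the minimizer \<open>u\<close>, whose penalty is thus
  \<open>O(\<delta> powr -\<gamma>2)\<close> and whose residual is \<open>O(\<delta>)\<close>; the lower norm equivalence turns the latter into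
  an \<open>\<ell>\<^sub>a\<close>-error bound \<open>O(\<delta>)\<close>. Finally the \<open>r\<close>-th power of each entry of the thresholded error
  is dominated by a combination of the \<open>a\<close>-th power of the error, the \<open>p\<close>-th power of \<open>u\<close> and the
  \<open>q\<close>-th power of \<open>u_dag\<close>, weighted with powers of \<open>\<beta>\<close> that make all three sums
  \<open>O(\<beta> powr (r - q))\<close>.
\<close>

section \<open>Power sums in place of norms and penalties\<close>

text \<open>
  Since \<open>0 powr 0 = 0\<close>, the case \<open>s = 0\<close> of the following sum counts the nonzero entries.
\<close>

definition psum :: "real \<Rightarrow> (nat \<Rightarrow> real) \<Rightarrow> ennreal" where
  "psum s u = (\<Sum>k. ennreal (\<bar>u k\<bar> powr s))"

lemma ennreal_powr_ennreal: "0 \<le> x \<Longrightarrow> ennreal_powr (ennreal x) t = ennreal (x powr t)"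
  by (simp add: ennreal_powr_def)

lemma ennreal_powr_eq_top_iff [simp]: "ennreal_powr x t = top \<longleftrightarrow> x = top"
  by (simp add: ennreal_powr_def)

lemma lnorm_eq_psum: "s \<noteq> 0 \<Longrightarrow> lnorm s u = ennreal_powr (psum s u) (1 / s)"
  by (simp add: lnorm_def psum_def)

lemma lnorm_zero_eq_psum: "lnorm 0 u = psum 0 u"
proof -
  have "lnorm 0 u = (\<integral>\<^sup>+k. indicator {k. u k \<noteq> 0} k \<partial>count_space UNIV)"
    by (simp add: lnorm_def)
  also have "\<dots> = (\<Sum>k. indicator {k. u k \<noteq> 0} k)"
    by (rule nn_integral_count_space_nat)
  also have "\<dots> = psum 0 u"
    unfolding psum_def by (intro suminf_cong) (simp add: indicator_def)
  finally show ?thesis .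
qed

lemma mem_ell_iff_psum: "u \<in> ell s \<longleftrightarrow> psum s u < top"
  by (cases "s = 0") (simp_all add: ell_def lnorm_zero_eq_psum lnorm_eq_psum less_top[symmetric])

lemma penalty_eq_psum: "penalty p u = psum p u"
proof (cases "p = 0")
  case False
  then show ?thesis
    by (cases "psum p u") (auto simp: penalty_def lnorm_eq_psum ennreal_powr_def powr_powr)
qed (simp add: penalty_def lnorm_zero_eq_psum)

text \<open>This lets all estimates be carried out on power sums; roots are taken only when a norm
  enters or leaves the argument.\<close>

lemma lnorm_le_iff_psum_le:
  assumes "0 < s" "0 \<le> c"
  shows "lnorm s u \<le> ennreal c \<longleftrightarrow> psum s u \<le> ennreal (c powr s)"
proof (cases "psum s u")
  case (real x)
  have "x powr (1 / s) \<le> c \<longleftrightarrow> (x powr (1 / s)) powr s \<le> c powr s"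
    using assms powr_mono2[of s "x powr (1 / s)" c] powr_less_mono2[of s c "x powr (1 / s)"]
    by (cases "x powr (1 / s) \<le> c") auto
  also have "(x powr (1 / s)) powr s = x"
    using assms real by (simp add: powr_powr)
  finally show ?thesis
    using assms real by (simp add: lnorm_eq_psum ennreal_powr_ennreal)
next
  case top
  then show ?thesis
    using assms by (simp add: lnorm_eq_psum ennreal_powr_def top_unique)
qed

text \<open>Series in \<open>ennreal\<close> are additive and monotone even when they diverge, so an
  entrywise estimate can be summed directly. The variants with fewer terms are instances with
  coefficient 0.\<close>

lemma psum_le_cmult_add3:
  assumes "\<And>k. \<bar>w k\<bar> powr s \<le> c * \<bar>u k\<bar> powr t + c' * \<bar>u' k\<bar> powr t' + c'' * \<bar>u'' k\<bar> powr t''"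
    and "0 \<le> c" "0 \<le> c'" "0 \<le> c''"
  shows "psum s w \<le> ennreal c * psum t u + ennreal c' * psum t' u' + ennreal c'' * psum t'' u''"
proof -
  have "psum s w \<le> (\<Sum>k. ennreal c * ennreal (\<bar>u k\<bar> powr t) + ennreal c' * ennreal (\<bar>u' k\<bar> powr t')
      + ennreal c'' * ennreal (\<bar>u'' k\<bar> powr t''))"
    unfolding psum_def using assms
    by (intro suminf_le) (auto simp flip: ennreal_mult ennreal_plus intro!: ennreal_leI)
  also have "\<dots> = ennreal c * psum t u + ennreal c' * psum t' u' + ennreal c'' * psum t'' u''"
    unfolding psum_def by (simp add: suminf_add[symmetric] ennreal_suminf_cmult)
  finally show ?thesis .
qed

lemma psum_le_cmult_add:
  assumes "\<And>k. \<bar>w k\<bar> powr s \<le> c * \<bar>u k\<bar> powr t + c' * \<bar>u' k\<bar> powr t'" "0 \<le> c" "0 \<le> c'"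
  shows "psum s w \<le> ennreal c * psum t u + ennreal c' * psum t' u'"
  using psum_le_cmult_add3[of w s c u t c' u' t' 0 u' t'] assms by simp

lemma psum_le_cmult:
  assumes "\<And>k. \<bar>w k\<bar> powr s \<le> c * \<bar>u k\<bar> powr t" "0 \<le> c"
  shows "psum s w \<le> ennreal c * psum t u"
  using psum_le_cmult_add[of w s c u t 0 u t] assms by simp

section \<open>Linear structure of the sequence spaces\<close>

lemma ell_cmult: "u \<in> ell s \<Longrightarrow> (\<lambda>k. c * u k) \<in> ell s"
proof -
  assume "u \<in> ell s"
  moreover have "psum s (\<lambda>k. c * u k) \<le> ennreal (\<bar>c\<bar> powr s) * psum s u"
    by (rule psum_le_cmult) (simp_all add: abs_mult powr_mult)
  ultimately show ?thesis
    by (auto simp: mem_ell_iff_psum ennreal_mult_less_top intro: le_less_trans)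
qed

text \<open>Bounding the sum by twice the maximum gives a crude constant, but it works uniformly for
  exponents below and above 1.\<close>

lemma powr_add_le:
  fixes x y :: real
  assumes "0 \<le> x" "0 \<le> y" "0 \<le> s"
  shows "(x + y) powr s \<le> 2 powr s * (x powr s + y powr s)"
proof -
  have "(x + y) powr s \<le> (2 * max x y) powr s"
    using assms by (intro powr_mono2) auto
  also have "\<dots> = 2 powr s * max x y powr s"
    using assms by (simp add: powr_mult)
  also have "\<dots> \<le> 2 powr s * (x powr s + y powr s)"
    by (intro mult_left_mono) (auto simp: max_def)
  finally show ?thesis .
qed

lemma ell_add:
  assumes "u \<in> ell s" "w \<in> ell s" "0 < s"
  shows "(\<lambda>k. u k + w k) \<in> ell s"
proof -
  have "\<bar>u k + w k\<bar> powr s \<le> 2 powr s * \<bar>u k\<bar> powr s + 2 powr s * \<bar>w k\<bar> powr s" for k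
  proof -
    have "\<bar>u k + w k\<bar> powr s \<le> (\<bar>u k\<bar> + \<bar>w k\<bar>) powr s"
      using assms by (intro powr_mono2) auto
    also have "\<dots> \<le> 2 powr s * (\<bar>u k\<bar> powr s + \<bar>w k\<bar> powr s)"
      using assms by (intro powr_add_le) auto
    finally show ?thesis by (simp add: distrib_left)
  qed
  then have "psum s (\<lambda>k. u k + w k)
      \<le> ennreal (2 powr s) * psum s u + ennreal (2 powr s) * psum s w"
    by (intro psum_le_cmult_add) auto
  also have "\<dots> < top"
    using assms by (simp add: mem_ell_iff_psum ennreal_mult_less_top)
  finally show ?thesis by (simp add: mem_ell_iff_psum)
qed

lemma ell_diff:
  assumes "u \<in> ell s" "w \<in> ell s" "0 < s"
  shows "(\<lambda>k. u k - w k) \<in> ell s"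
  using ell_add[OF assms(1) ell_cmult[OF assms(2), of "-1"] assms(3)] by simp

lemma bounded_linear_on_ell_diff:
  assumes "bounded_linear_on_ell s A" "u \<in> ell s" "w \<in> ell s"
  shows "A (\<lambda>k. u k - w k) = A u - A w"
proof -
  have add: "A (\<lambda>k. x k + z k) = A x + A z" if "x \<in> ell s" "z \<in> ell s" for x z
    using assms(1) that by (simp add: bounded_linear_on_ell_def)
  have scale: "A (\<lambda>k. c * x k) = c *\<^sub>R A x" if "x \<in> ell s" for c x
    using assms(1) that by (simp add: bounded_linear_on_ell_def)
  show ?thesis
    using add[OF assms(2) ell_cmult[OF assms(3), of "-1"]] scale[OF assms(3), of "-1"] by simp
qed

section \<open>Trading exponents and hard thresholding\<close>

lemma powr_le_smaller_exponent:
  fixes x b :: real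
  assumes "0 \<le> x" "x \<le> b" "s \<le> t"
  shows "x powr t \<le> b powr (t - s) * x powr s"
proof -
  have "x powr t = x powr (t - s) * x powr s"
    by (simp flip: powr_add)
  also have "\<dots> \<le> b powr (t - s) * x powr s"
    using assms by (intro mult_right_mono powr_mono2) auto
  finally show ?thesis .
qed

lemma powr_le_larger_exponent:
  fixes x b :: real
  assumes "0 < b" "b \<le> x" "s \<le> t"
  shows "x powr s \<le> b powr (s - t) * x powr t"
proof -
  have "x powr s = x powr (s - t) * x powr t"
    by (simp flip: powr_add)
  also have "\<dots> \<le> b powr (s - t) * x powr t"
    using assms by (intro mult_right_mono powr_mono2') auto
  finally show ?thesis .
qed

lemma psum_hard_threshold_le_psum: "psum s (hard_threshold b u) \<le> psum s u"
  using psum_le_cmult[of "hard_threshold b u" s 1 u s] by (simp add: hard_threshold_def)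

text \<open>A Chebyshev-type estimate: every surviving entry has size at least \<open>b\<close>. For
  \<open>s = 0\<close> it bounds their number.\<close>

lemma psum_hard_threshold_le:
  assumes "0 < b" "s \<le> t"
  shows "psum s (hard_threshold b u) \<le> ennreal (b powr (s - t)) * psum t u"
  using assms
  by (intro psum_le_cmult) (auto simp: hard_threshold_def intro: powr_le_larger_exponent)

lemma psum_hard_threshold_diff_le:
  assumes "0 \<le> b" "s \<le> t"
  shows "psum t (\<lambda>k. hard_threshold b u k - u k) \<le> ennreal (b powr (t - s)) * psum s u"
  using assms
  by (intro psum_le_cmult) (auto simp: hard_threshold_def intro: powr_le_smaller_exponent)

text \<open>The target exponent \<open>s\<close> is arbitrary because only finitely many entries
  survive.\<close>

lemma hard_threshold_mem_ell:
  assumes "u \<in> ell q" "0 \<le> q" "0 < b"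
  shows "hard_threshold b u \<in> ell s"
proof -
  let ?w = "hard_threshold b u"
  have "psum 0 ?w \<le> ennreal (b powr (0 - q)) * psum q u"
    using assms by (intro psum_hard_threshold_le) auto
  also have "\<dots> < top"
    using assms by (simp add: mem_ell_iff_psum ennreal_mult_less_top)
  finally have "emeasure (count_space UNIV) {k. ?w k \<noteq> 0} < top"
    by (simp add: lnorm_zero_eq_psum[symmetric] lnorm_def)
  then have fin: "finite {k. ?w k \<noteq> 0}"
    by (auto simp: emeasure_count_space split: if_splits)
  have "psum s ?w = (\<Sum>k\<in>{k. ?w k \<noteq> 0}. ennreal (\<bar>?w k\<bar> powr s))"
    unfolding psum_def by (rule suminf_finite[OF fin]) auto
  also have "\<dots> < top" by (simp add: fin)
  finally show ?thesis by (simp add: mem_ell_iff_psum)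
qed

text \<open>Split at level 1: the large entries are finite in number, and on the small ones a larger
  exponent only decreases the power.\<close>

lemma ell_mono:
  assumes "0 \<le> q" "q \<le> r" "0 < r" "u \<in> ell q"
  shows "u \<in> ell r"
proof -
  let ?w = "hard_threshold 1 u"
  have w: "?w \<in> ell r"
    using assms by (intro hard_threshold_mem_ell) auto
  have "psum r (\<lambda>k. ?w k - u k) \<le> ennreal (1 powr (r - q)) * psum q u"
    using assms by (intro psum_hard_threshold_diff_le) auto
  then have "(\<lambda>k. ?w k - u k) \<in> ell r"
    using assms by (auto simp: mem_ell_iff_psum)
  from ell_diff[OF w this] show ?thesis using assms by simp
qed

section \<open>Entrywise splitting of the thresholded error\<close>

text \<open>
  The entries are split according to \<open>\<bar>x\<bar> \<ge> b\<close> and, if \<open>\<bar>x\<bar> < b\<close>, according to \<open>\<bar>e\<bar> \<ge> 2 b\<close>, in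
  which case \<open>\<bar>x - e\<bar>\<close> is at least both \<open>b\<close> and \<open>\<bar>e\<bar> / 2\<close>.
\<close>

lemma threshold_error_pointwise:
  fixes x e b :: real
  assumes "0 < b" "0 \<le> p" "0 \<le> q" "q \<le> r" "r \<le> a"
  shows "\<bar>(if b \<le> \<bar>x\<bar> then x else 0) - e\<bar> powr r
    \<le> 2 powr r * b powr (r - a) * \<bar>x - e\<bar> powr a + b powr (r - p) * \<bar>x\<bar> powr p
      + (2 * b) powr (r - q) * \<bar>e\<bar> powr q"
proof -
  have r: "0 \<le> r" using assms by simp
  have two: "1 \<le> (2::real) powr r" using r by (simp add: ge_one_powr_ge_zero)
  have nonneg: "0 \<le> 2 powr r * b powr (r - a) * \<bar>x - e\<bar> powr a" "0 \<le> b powr (r - p) * \<bar>x\<bar> powr p"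
      "0 \<le> (2 * b) powr (r - q) * \<bar>e\<bar> powr q"
    by auto
  have large: "\<bar>x - e\<bar> powr r \<le> b powr (r - a) * \<bar>x - e\<bar> powr a" if "b \<le> \<bar>x - e\<bar>"
    using assms that by (intro powr_le_larger_exponent)
  consider "b \<le> \<bar>x\<bar>" "b \<le> \<bar>x - e\<bar>" | "b \<le> \<bar>x\<bar>" "\<bar>x - e\<bar> < b"
    | "\<bar>x\<bar> < b" "2 * b \<le> \<bar>e\<bar>" | "\<bar>x\<bar> < b" "\<bar>e\<bar> < 2 * b"
    by linarith
  then show ?thesis
  proof cases
    case 1
    have "\<bar>x - e\<bar> powr r \<le> 1 * (b powr (r - a) * \<bar>x - e\<bar> powr a)"
      using 1 large by simp
    also have "\<dots> \<le> 2 powr r * (b powr (r - a) * \<bar>x - e\<bar> powr a)"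
      using two by (intro mult_right_mono) auto
    finally show ?thesis using 1(1) nonneg by (simp only: mult.assoc if_True)
  next
    case 2
    have "\<bar>x - e\<bar> powr r \<le> b powr r"
      using 2 r by (intro powr_mono2) auto
    \<comment> \<open>As \<open>b\<close> is positive, the next comparison also covers
      \<open>p = 0\<close>, where both \<open>p\<close>-th powers equal 1.\<close>
    also have "\<dots> = b powr (r - p) * b powr p"
      by (simp flip: powr_add)
    also have "\<dots> \<le> b powr (r - p) * \<bar>x\<bar> powr p"
      using 2 assms by (intro mult_left_mono powr_mono2) auto
    finally show ?thesis using 2(1) nonneg by (simp only: if_True)
  next
    case 3
    have "\<bar>e\<bar> \<le> 2 * \<bar>x - e\<bar>" "b \<le> \<bar>x - e\<bar>"
      using 3 abs_triangle_ineq2[of e x] by (simp_all add: abs_minus_commute)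
    then have "\<bar>e\<bar> powr r \<le> (2 * \<bar>x - e\<bar>) powr r"
      using r by (intro powr_mono2) auto
    also have "\<dots> = 2 powr r * \<bar>x - e\<bar> powr r"
      by (simp add: powr_mult)
    also have "\<dots> \<le> 2 powr r * (b powr (r - a) * \<bar>x - e\<bar> powr a)"
      using \<open>b \<le> \<bar>x - e\<bar>\<close> by (intro mult_left_mono large) auto
    finally show ?thesis using 3(1) nonneg
      by (simp only: mult.assoc not_le[symmetric] if_False diff_0 abs_minus_cancel)
  next
    case 4
    have "\<bar>e\<bar> powr r \<le> (2 * b) powr (r - q) * \<bar>e\<bar> powr q"
      using 4 assms by (intro powr_le_smaller_exponent) auto
    then show ?thesis using 4(1) nonneg
      by (simp only: not_le[symmetric] if_False diff_0 abs_minus_cancel)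
  qed
qed

lemma psum_threshold_error_le:
  assumes "0 < b" "0 \<le> p" "0 \<le> q" "q \<le> r" "r \<le> a"
  shows "psum r (\<lambda>k. hard_threshold b u k - e k)
    \<le> ennreal (2 powr r * b powr (r - a)) * psum a (\<lambda>k. u k - e k)
      + ennreal (b powr (r - p)) * psum p u + ennreal ((2 * b) powr (r - q)) * psum q e"
  using assms threshold_error_pointwise[OF assms]
  by (intro psum_le_cmult_add3) (auto simp: hard_threshold_def)

section \<open>Convergence rates\<close>

theorem corollary15:
  fixes p q r a \<sigma> d1 d2 :: real
    and A :: "(nat \<Rightarrow> real) \<Rightarrow> 'v::banach"
    and u_dag :: "nat \<Rightarrow> real"
    and v :: 'v
    and v_noisy :: "real \<Rightarrow> 'v"
    and u_min v_thr :: "real \<Rightarrow> nat \<Rightarrow> real"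
    and \<alpha> \<beta> :: "real \<Rightarrow> real"
    and \<gamma>1 \<gamma>2 :: real
  assumes "0 \<le> p" "p \<le> q" "q \<le> r" "1 \<le> r" "r < a"
    and "0 < \<sigma>"
    and "bounded_linear_on_ell r A"
    and "inj_on A (ell r)"
    and "\<not> compact_operator_on_ell r A"
    and "\<not> closed (A ` ell r)"
    and "0 < d1" "d1 \<le> d2"
    and "\<And>u. u \<in> ell r \<Longrightarrow> ennreal d1 * lnorm a u \<le> ennreal (norm (A u))"
    and "\<And>u. u \<in> ell r \<Longrightarrow> ennreal (norm (A u)) \<le> ennreal d2 * lnorm a u"
    and "u_dag \<in> ell q"
    and "v = A u_dag"
    and "\<And>\<delta>. 0 < \<delta> \<Longrightarrow> norm (v_noisy \<delta> - v) \<le> \<delta>"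
    and "\<And>\<delta>. 0 < \<delta> \<Longrightarrow> \<alpha> \<delta> = \<delta> powr (\<sigma> + (q - p) * a / (a - q))"
    and "\<And>\<delta>. 0 < \<delta> \<Longrightarrow> u_min \<delta> \<in> ell p"
    and "\<And>\<delta>. 0 < \<delta> \<Longrightarrow>
          is_arg_min (tikhonov A \<sigma> p (\<alpha> \<delta>) (v_noisy \<delta>)) (\<lambda>u. u \<in> ell r) (u_min \<delta>)"
    and "\<And>\<delta>. 0 < \<delta> \<Longrightarrow> \<beta> \<delta> = \<delta> powr (a / (a - q))"
    and "\<And>\<delta>. 0 < \<delta> \<Longrightarrow> v_thr \<delta> = hard_threshold (\<beta> \<delta>) (u_min \<delta>)"
    and "\<gamma>1 = a / r * ((r - q) / (a - q))"
    and "\<gamma>2 = (q - p) * a / (a - q)"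
  shows "(\<exists>C::real. \<forall>\<^sub>F \<delta> in at_right 0.
            lnorm r (\<lambda>k. v_thr \<delta> k - u_dag k) \<le> ennreal (C * \<delta> powr \<gamma>1))
       \<and> (\<exists>C::real. \<forall>\<^sub>F \<delta> in at_right 0.
            penalty p (v_thr \<delta>) \<le> ennreal (C * \<delta> powr (- \<gamma>2)))"
proof -
  note params = assms(1-6)
  have q: "0 \<le> q" and r: "0 < r" and a: "0 < a" and aq: "0 < a - q" and qr: "q \<le> r"
    using params by auto
  define E where "E = enn2real (psum q u_dag)"
  have E: "psum q u_dag = ennreal E" "0 \<le> E"
    using assms(15) by (simp_all add: E_def mem_ell_iff_psum)
  \<comment> \<open>In units of \<open>\<delta> powr \<sigma>\<close>, the two summands of
    \<open>K\<close> bound the residual term and the weighted penalty of the truncated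
    \<open>u_dag\<close>. \<open>D * \<delta>\<close> will bound the \<open>a\<close>-norm error of
    the minimizer: residual plus noise, divided by \<open>d1\<close>. \<open>M\<close> collects the
    three terms of the entrywise splitting.\<close>
  define K where "K = (1 + d2 * E powr (1 / a)) powr \<sigma> + E"
  define D where "D = (K powr (1 / \<sigma>) + 1) / d1"
  define M where "M = 2 powr r * D powr a + K + 2 powr (r - q) * E"
  have K: "0 \<le> K" and D: "0 \<le> D"
    using E assms(11) by (simp_all add: K_def D_def)
  have M: "0 \<le> M"
    using E K by (simp add: M_def)
  have dag: "u_dag \<in> ell r"
    using ell_mono[OF q qr r assms(15)] .
  \<comment> \<open>The bounds hold for every positive \<open>\<delta>\<close>, with constants
    independent of it.\<close>
  have main: "lnorm r (\<lambda>k. v_thr \<delta> k - u_dag k) \<le> ennreal (M powr (1 / r) * \<delta> powr \<gamma>1)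
      \<and> penalty p (v_thr \<delta>) \<le> ennreal (K * \<delta> powr (- \<gamma>2))" if \<delta>: "0 < \<delta>" for \<delta>
  proof -
    define b y u w where "b = \<beta> \<delta>" and "y = v_noisy \<delta>" and "u = u_min \<delta>"
      and "w = hard_threshold b u_dag"
    have b_eq: "b = \<delta> powr (a / (a - q))"
      using assms(21) \<delta> by (simp add: b_def)
    have b: "0 < b" using \<delta> by (simp add: b_eq)
    \<comment> \<open>The first identity explains the choice of the level: truncating
      \<open>u_dag\<close> at \<open>b\<close> costs an \<open>a\<close>-norm error of order
      \<open>\<delta>\<close>, the same as the noise.\<close>
    have b_a: "b powr (a - q) = \<delta> powr a" and b_p: "b powr (p - q) = \<delta> powr (- \<gamma>2)"
      and b_r: "b powr (r - q) = (\<delta> powr \<gamma>1) powr r"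
    proof -
      have "a / (a - q) * (a - q) = a" "a / (a - q) * (p - q) = - \<gamma>2"
        and "a / (a - q) * (r - q) = \<gamma>1 * r"
        using aq r by (simp_all add: assms(23,24) divide_simps) algebra+
      then show "b powr (a - q) = \<delta> powr a" "b powr (p - q) = \<delta> powr (- \<gamma>2)"
        "b powr (r - q) = (\<delta> powr \<gamma>1) powr r"
        by (simp_all only: b_eq powr_powr)
    qed
    have \<alpha>_eq: "\<alpha> \<delta> = \<delta> powr (\<sigma> + \<gamma>2)"
      using assms(18)[OF \<delta>] assms(24) by simp
    have w: "w \<in> ell r"
      unfolding w_def using hard_threshold_mem_ell[OF assms(15) q b] .
    have u: "u \<in> ell r" and min: "tikhonov A \<sigma> p (\<alpha> \<delta>) y u \<le> tikhonov A \<sigma> p (\<alpha> \<delta>) y w"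
      using assms(20)[OF \<delta>] w by (auto simp: is_arg_min_def u_def y_def not_less)
    have noise: "norm (A u_dag - y) \<le> \<delta>"
      using assms(17)[OF \<delta>] assms(16) by (simp add: y_def norm_minus_commute)

    have "psum a (\<lambda>k. w k - u_dag k) \<le> ennreal (b powr (a - q)) * psum q u_dag"
      unfolding w_def using b params by (intro psum_hard_threshold_diff_le) auto
    also have "\<dots> = ennreal ((\<delta> * E powr (1 / a)) powr a)"
      using E a \<delta> by (simp add: b_a powr_mult powr_powr ennreal_mult)
    finally have "lnorm a (\<lambda>k. w k - u_dag k) \<le> ennreal (\<delta> * E powr (1 / a))"
      using a \<delta> by (subst lnorm_le_iff_psum_le) auto
    then have "ennreal d2 * lnorm a (\<lambda>k. w k - u_dag k) \<le> ennreal d2 * ennreal (\<delta> * E powr (1 / a))"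
      by (rule mult_left_mono) simp
    moreover have "ennreal (norm (A w - A u_dag)) \<le> ennreal d2 * lnorm a (\<lambda>k. w k - u_dag k)"
      using assms(14)[OF ell_diff[OF w dag r]] bounded_linear_on_ell_diff[OF assms(7) w dag] by simp
    ultimately have "ennreal (norm (A w - A u_dag)) \<le> ennreal (d2 * (\<delta> * E powr (1 / a)))"
      using assms(11,12) \<delta> by (simp add: ennreal_mult)
    then have "norm (A w - A u_dag) \<le> d2 * (\<delta> * E powr (1 / a))"
      using assms(11,12) \<delta> by simp
    then have "norm (A w - y) \<le> \<delta> * (1 + d2 * E powr (1 / a))"
      using noise norm_triangle_ineq[of "A w - A u_dag" "A u_dag - y"] by (simp add: algebra_simps)
    then have "norm (A w - y) powr \<sigma> \<le> (\<delta> * (1 + d2 * E powr (1 / a))) powr \<sigma>"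
      using assms(6) by (intro powr_mono2) auto
    then have res_w: "norm (A w - y) powr \<sigma> \<le> (1 + d2 * E powr (1 / a)) powr \<sigma> * \<delta> powr \<sigma>"
      using \<delta> assms(11,12) by (simp add: powr_mult mult.commute)
    have "psum p w \<le> ennreal (b powr (p - q)) * psum q u_dag"
      unfolding w_def using b params by (intro psum_hard_threshold_le) auto
    then have "ennreal (\<alpha> \<delta>) * penalty p w \<le> ennreal (\<alpha> \<delta>) * (ennreal (\<delta> powr (- \<gamma>2)) * ennreal E)"
      by (intro mult_left_mono) (auto simp: penalty_eq_psum E b_p)
    also have "\<dots> = ennreal (\<alpha> \<delta> * \<delta> powr (- \<gamma>2) * E)"
      using E by (simp add: \<alpha>_eq ennreal_mult mult.assoc)
    \<comment> \<open>The extra exponent \<open>\<gamma>2\<close> in the regularization parameter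
      exactly cancels the growth of the penalty of \<open>w\<close>, balancing it with the
      residual.\<close>
    also have "\<alpha> \<delta> * \<delta> powr (- \<gamma>2) = \<delta> powr \<sigma>"
      by (simp add: \<alpha>_eq flip: powr_add)
    finally have "tikhonov A \<sigma> p (\<alpha> \<delta>) y w
        \<le> ennreal ((1 + d2 * E powr (1 / a)) powr \<sigma> * \<delta> powr \<sigma>) + ennreal (\<delta> powr \<sigma> * E)"
      unfolding tikhonov_def using res_w by (intro add_mono ennreal_leI)
    also have "\<dots> = ennreal (K * \<delta> powr \<sigma>)"
      using E by (simp add: K_def algebra_simps flip: ennreal_plus)
    finally have T: "tikhonov A \<sigma> p (\<alpha> \<delta>) y u \<le> ennreal (K * \<delta> powr \<sigma>)"
      using min by simp

    \<comment> \<open>Both Tikhonov summands are nonnegative, so \<open>T\<close> bounds each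
      separately: the residual here, the penalty further below.\<close>
    have "ennreal (norm (A u - y) powr \<sigma>) \<le> ennreal (K * \<delta> powr \<sigma>)"
      using T unfolding tikhonov_def by (rule order_trans[rotated]) simp
    then have "norm (A u - y) powr \<sigma> \<le> K * \<delta> powr \<sigma>"
      using K by simp
    then have "(norm (A u - y) powr \<sigma>) powr (1 / \<sigma>) \<le> (K * \<delta> powr \<sigma>) powr (1 / \<sigma>)"
      using assms(6) by (intro powr_mono2) auto
    then have "norm (A u - y) \<le> K powr (1 / \<sigma>) * \<delta>"
      using K \<delta> assms(6) by (simp add: powr_mult powr_powr)
    then have res: "norm (A u - A u_dag) \<le> d1 * (D * \<delta>)"
      using noise norm_triangle_ineq4[of "A u - y" "A u_dag - y"] assms(11)
      by (simp add: D_def distrib_right)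
    have "ennreal d1 * lnorm a (\<lambda>k. u k - u_dag k) \<le> ennreal (norm (A u - A u_dag))"
      using assms(13)[OF ell_diff[OF u dag r]] bounded_linear_on_ell_diff[OF assms(7) u dag] by simp
    also have "\<dots> \<le> ennreal (d1 * (D * \<delta>))"
      using res by (rule ennreal_leI)
    also have "\<dots> = ennreal d1 * ennreal (D * \<delta>)"
      using assms(11) D \<delta> by (simp add: ennreal_mult)
    finally have "lnorm a (\<lambda>k. u k - u_dag k) \<le> ennreal (D * \<delta>)"
      using assms(11) by (simp add: ennreal_mult_le_mult_iff)
    then have err: "psum a (\<lambda>k. u k - u_dag k) \<le> ennreal (D powr a * \<delta> powr a)"
      using a D \<delta> by (simp add: lnorm_le_iff_psum_le powr_mult)

    have "ennreal (\<delta> powr (\<sigma> + \<gamma>2)) * psum p u \<le> ennreal (K * \<delta> powr \<sigma>)"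
      using T unfolding tikhonov_def penalty_eq_psum \<alpha>_eq by (rule order_trans[rotated]) simp
    also have "K * \<delta> powr \<sigma> = \<delta> powr (\<sigma> + \<gamma>2) * (K * \<delta> powr (- \<gamma>2))"
      by (simp add: mult.left_commute flip: powr_add)
    also have "ennreal \<dots> = ennreal (\<delta> powr (\<sigma> + \<gamma>2)) * ennreal (K * \<delta> powr (- \<gamma>2))"
      using K by (simp add: ennreal_mult)
    finally have pen: "psum p u \<le> ennreal (K * \<delta> powr (- \<gamma>2))"
      using \<delta> by (simp add: ennreal_mult_le_mult_iff)

    have thr: "v_thr \<delta> = hard_threshold b u"
      using assms(22)[OF \<delta>] by (simp add: b_def u_def)
    have "psum r (\<lambda>k. v_thr \<delta> k - u_dag k)
        \<le> ennreal (2 powr r * b powr (r - a)) * psum a (\<lambda>k. u k - u_dag k)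
          + ennreal (b powr (r - p)) * psum p u + ennreal ((2 * b) powr (r - q)) * psum q u_dag"
      unfolding thr using b params by (intro psum_threshold_error_le) auto
    also have "\<dots> \<le> ennreal (2 powr r * b powr (r - a)) * ennreal (D powr a * b powr (a - q))
          + ennreal (b powr (r - p)) * ennreal (K * b powr (p - q))
          + ennreal ((2 * b) powr (r - q)) * ennreal E"
      using err pen by (intro add_mono mult_left_mono) (auto simp: b_a b_p E)
    also have "\<dots> = ennreal (2 powr r * D powr a * (b powr (r - a) * b powr (a - q))
          + K * (b powr (r - p) * b powr (p - q)) + (2 * b) powr (r - q) * E)"
      using K E by (simp add: mult_ac flip: ennreal_mult ennreal_plus)
    \<comment> \<open>In each of the three terms the exponents of \<open>b\<close> add up to
      \<open>r - q\<close>.\<close>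
    also have "\<dots> = ennreal (M * b powr (r - q))"
      using b by (simp add: M_def powr_mult algebra_simps flip: powr_add)
    also have "M * b powr (r - q) = (M powr (1 / r) * \<delta> powr \<gamma>1) powr r"
      using M r by (simp add: b_r powr_mult powr_powr)
    finally have "lnorm r (\<lambda>k. v_thr \<delta> k - u_dag k) \<le> ennreal (M powr (1 / r) * \<delta> powr \<gamma>1)"
      using r by (subst lnorm_le_iff_psum_le) auto
    \<comment> \<open>Thresholding cannot increase the penalty, so the bound for the minimizer
      carries over.\<close>
    moreover have "penalty p (v_thr \<delta>) \<le> ennreal (K * \<delta> powr (- \<gamma>2))"
      using pen psum_hard_threshold_le_psum[of p b u] by (auto simp: penalty_eq_psum thr)
    ultimately show ?thesis ..
  qed
  have pos: "\<forall>\<^sub>F \<delta>::real in at_right 0. 0 < \<delta>"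
    by (rule eventually_at_right_less)
  show ?thesis
    by (intro conjI exI; rule eventually_mono[OF pos]) (use main in blast)+
qed

end
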